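(* Let $q$ be a prime power, let $F$ be a field containing $\mathbb{F}_q$, let $d\ge 0$, and let $f(z)=\sum_{i=0}^{d} f_i z^{q^i}\in F[z]$ with $f_d\neq 0$. Put $u=1/z$ and expand $-zf'(z)/f(z)=\sum_{i\ge 0} H_i u^i$ as a power series in $u$. Then for every integer $s$ with $1\le s\le q$ and all integers $k_1,\dots,k_s\ge 1$, $$\prod_{i=1}^s H_{q^{k_i}-1} = H_{q^{k_1}+\dots+q^{k_s}-s}.$$
   Context: Here $f'(z)=f_0$, and $zf'(z)/f(z)=(f_0/f_d)\,u^{q^d-1}\big(1+\sum_{j<d}(f_j/f_d)u^{q^d-q^j}\big)^{-1}$, which is a power series in $u$. *)

theory Defs
  imports
    "HOL-Algebra.Algebraic_Closure_Type"
    "HOL-Computational_Algebra.Computational_Algebra"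
    "HOL-Number_Theory.Prime_Powers"
begin

(* The indeterminate of the Laurent series is u = 1/z, so fls_X_inv is z. *)
definition poly_at_inf :: "'a::field poly \<Rightarrow> 'a fls" where
  "poly_at_inf p = poly (map_poly fls_const p) fls_X_inv"

definition neg_z_log_deriv :: "'a::field poly \<Rightarrow> 'a fls" where
  "neg_z_log_deriv p = - (fls_X_inv * poly_at_inf (pderiv p)) / poly_at_inf p"

lemma poly_at_inf_nth:
  "fls_nth (poly_at_inf p) n = (if n \<le> 0 then Polynomial.coeff p (nat (- n)) else 0)"
proof (induction p arbitrary: n)
  case 0
  then show ?case by (simp add: poly_at_inf_def)
next
  case (pCons a p)
  have "poly_at_inf (pCons a p) = fls_const a + fls_X_inv * poly_at_inf p"
    using pCons.hyps by (simp add: poly_at_inf_def map_poly_pCons)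
  moreover have "nat (- n) = Suc (nat (- 1 - n))" if "n < 0" using that by simp
  ultimately show ?case
    using pCons.IH by (auto simp: fls_X_inv_times_conv_shift algebra_simps)
qed

lemma poly_at_inf_subdegree:
  assumes "p \<noteq> 0"
  shows "fls_subdegree (poly_at_inf p) = - int (Polynomial.degree p)"
  using assms by (intro fls_subdegree_eqI) (auto simp: poly_at_inf_nth intro: coeff_eq_0)

lemma poly_at_inf_eq_0_iff: "poly_at_inf p = 0 \<longleftrightarrow> p = 0"
proof
  assume "poly_at_inf p = 0"
  then have "Polynomial.coeff p n = 0" for n
    using poly_at_inf_nth[of p "- int n"] by simp
  then show "p = 0" by (simp add: poly_eq_iff)
qed (simp add: poly_at_inf_def)

(* The expansion in u has no principal part: it really is a power series. *)
lemma neg_z_log_deriv_power_series: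
  assumes "p \<noteq> 0"
  shows "\<exists>!H. fps_to_fls H = neg_z_log_deriv p"
proof -
  have "0 \<le> fls_subdegree (neg_z_log_deriv p)"
  proof (cases "pderiv p = 0")
    case True
    then show ?thesis by (simp add: neg_z_log_deriv_def poly_at_inf_def)
  next
    case False
    then have "Polynomial.degree p \<noteq> 0"
      by (metis degree_eq_zeroE pderiv_singleton)
    moreover have "Polynomial.degree (pderiv p) \<le> Polynomial.degree p - 1"
      by (intro degree_le) (auto simp: coeff_pderiv coeff_eq_0)
    ultimately show ?thesis
      using False assms
      by (simp add: neg_z_log_deriv_def fls_divide_subdegree poly_at_inf_eq_0_iff
          poly_at_inf_subdegree)
  qed
  then have "fps_to_fls (fls_regpart (neg_z_log_deriv p)) = neg_z_log_deriv p"
    by simp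
  then show ?thesis by (metis fls_regpart_fps_trivial)
qed

end

theory Submission
  imports Defs "HOL-Number_Theory.Cong"
begin

text \<open>
  Put \<open>g = f / z\<close>. Since \<open>f' = f\<^sub>0\<close>, the series \<open>H\<close> satisfies \<open>g H = - f\<^sub>0\<close>, so the linear functional
  \<open>M p = [u\<^sup>0] (p(1/u) H) + p(0)\<close> vanishes on the ideal generated by \<open>g\<close>. Moreover \<open>M (z ^ n) = H\<^sub>n\<close>
  for \<open>n > 0\<close>, and \<open>M p = p(0)\<close> whenever \<open>deg p < deg g = q ^ d - 1\<close>, because \<open>H\<close> has order at least
  \<open>deg g\<close>. The Frobenius map shows that modulo \<open>g\<close> each \<open>z ^ (q ^ k - 1)\<close> is congruent to a
  polynomial \<open>P\<^sub>k\<close> of degree at most \<open>q ^ (d - 1) - 1\<close>. A product of at most \<open>q\<close> such polynomials still has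
  degree below \<open>q ^ d - 1\<close>, so on it \<open>M\<close> is evaluation at \<open>0\<close>, which is multiplicative.
\<close>

lemma poly_at_inf_pCons:
  "poly_at_inf (pCons a p) = fls_const a + fls_X_inv * poly_at_inf p"
  by (simp add: poly_at_inf_def map_poly_pCons)

lemma poly_at_inf_0 [simp]: "poly_at_inf 0 = 0"
  by (simp add: poly_at_inf_eq_0_iff)

lemma poly_at_inf_add: "poly_at_inf (p + r) = poly_at_inf p + poly_at_inf r"
  by (rule fls_eqI) (simp add: poly_at_inf_nth)

lemma poly_at_inf_diff: "poly_at_inf (p - r) = poly_at_inf p - poly_at_inf r"
  by (rule fls_eqI) (simp add: poly_at_inf_nth)

lemma poly_at_inf_smult: "poly_at_inf (Polynomial.smult a p) = fls_const a * poly_at_inf p"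
  by (rule fls_eqI) (simp add: poly_at_inf_nth)

lemma poly_at_inf_mult: "poly_at_inf (p * r) = poly_at_inf p * poly_at_inf r"
  by (induction p)
    (simp_all add: poly_at_inf_pCons poly_at_inf_add poly_at_inf_smult algebra_simps)

lemma poly_at_inf_monom: "poly_at_inf (monom 1 n) = fls_X_inv ^ n"
  by (rule fls_eqI) (auto simp: poly_at_inf_nth)

text \<open>The bound is asked only for nonzero \<open>b\<close> because the zero series has
  subdegree 0 by convention. This matters when \<open>b\<close> is the series \<open>H\<close>,
  which vanishes if \<open>c 0 = 0\<close>.\<close>

lemma fls_nth_mult_eq_0:
  fixes a b :: "'a::semiring_no_zero_divisors fls"
  assumes "b \<noteq> 0 \<Longrightarrow> n < fls_subdegree a + fls_subdegree b"
  shows "fls_nth (a * b) n = 0"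
proof (cases "a = 0 \<or> b = 0")
  case False
  then show ?thesis using assms by (intro fls_eq0_below_subdegree) simp
qed auto

text \<open>Translation by 1 permutes \<open>K\<close>, so the sum of all elements of
  \<open>K\<close> is unchanged when \<open>card K\<close> ones are added to it.\<close>

lemma of_nat_card_subfield_eq_0:
  fixes K :: "'a::field set"
  assumes "subfield K (ring_of_type_algebra :: 'a ring)" and "finite K"
  shows "of_nat (card K) = (0 :: 'a)"
proof -
  have one: "1 \<in> K" and add: "\<And>x y. x \<in> K \<Longrightarrow> y \<in> K \<Longrightarrow> x + y \<in> K"
    using subringE(3,7)[OF subfieldE(1)[OF assms(1)]]
    by (auto simp: ring_of_type_algebra_def)
  have "(\<lambda>x. x + 1) ` K = K"
    using assms(2) one add by (intro card_subset_eq) (auto simp: card_image)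
  then have "(\<Sum>x\<in>K. x) = (\<Sum>x\<in>(\<lambda>x. x + 1) ` K. x)" by simp
  also have "\<dots> = (\<Sum>x\<in>K. x) + of_nat (card K)"
    by (subst sum.reindex) (auto simp: sum.distrib)
  finally show ?thesis by simp
qed

text \<open>This turns the \<open>q\<close>-th power map into an iterate of the Frobenius map, so
  that it is additive. The characteristic divides a prime power, hence is positive and therefore
  prime.\<close>

lemma primepow_eq_CHAR_power:
  assumes "primepow q" and "of_nat q = (0 :: 'a::idom)"
  obtains e where "q = CHAR('a) ^ e" and "prime CHAR('a)"
proof -
  obtain p e where p: "prime p" "e > 0" "q = p ^ e"
    using assms(1) by (auto simp: primepow_def)
  have "CHAR('a) dvd p ^ e" using assms(2) p(3) of_nat_eq_0_iff_char_dvd by blast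
  then obtain i where i: "CHAR('a) = p ^ i" using divides_primepow_nat p(1) by blast
  have "CHAR('a) > 0" using i p(1) by (simp add: prime_gt_0_nat)
  then have "prime CHAR('a)" by (rule prime_CHAR_semidom)
  moreover from this have "CHAR('a) = p"
    using i p(1) by (metis prime_dvd_power primes_dvd_imp_eq dvd_refl)
  ultimately show thesis using that p by blast
qed

lemma prod_monom: "(\<Prod>i\<in>A. monom 1 (n i)) = monom (1::'a::comm_semiring_1) (\<Sum>i\<in>A. n i)"
  by (induction A rule: infinite_finite_induct) (simp_all add: mult_monom)

lemma linearized_power_eq:
  fixes c :: "nat \<Rightarrow> 'a::idom"
  assumes "primepow q" and "of_nat q = (0 :: 'a)"
  shows "(\<Sum>i\<le>d. monom (c i) (q ^ i)) ^ (q ^ m) = (\<Sum>i\<le>d. monom (c i ^ q ^ m) (q ^ (i + m)))"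
proof -
  obtain e where e: "q = CHAR('a) ^ e" "prime CHAR('a)"
    using primepow_eq_CHAR_power[OF assms] by metis
  have "(\<Sum>i\<le>d. monom (c i) (q ^ i)) ^ (q ^ m) = (\<Sum>i\<le>d. monom (c i) (q ^ i) ^ (q ^ m))"
    by (rule freshmans_dream_sum'[where n = "e * m"]) (use e in \<open>auto simp: power_mult\<close>)
  then show ?thesis by (simp add: monom_power power_add mult.commute)
qed

lemma linearized_eq_X_times:
  fixes c :: "nat \<Rightarrow> 'a::comm_semiring_1"
  assumes "q > 0"
  shows "(\<Sum>i\<le>d. monom (c i) (q ^ i)) = monom 1 1 * (\<Sum>i\<le>d. monom (c i) (q ^ i - 1))"
  using assms by (simp add: sum_distrib_left mult_monom)

lemma monom_cong_low_degree:
  fixes c :: "nat \<Rightarrow> 'a::field"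
  assumes q: "primepow q" "of_nat q = (0 :: 'a)"
    and cd: "c d \<noteq> 0"
    and g: "g = (\<Sum>i\<le>d. monom (c i) (q ^ i - 1))"
  shows "\<exists>P. [monom 1 (q ^ k - 1) = P] (mod g) \<and> Polynomial.degree P \<le> q ^ (d - 1) - 1"
proof (induction k rule: less_induct)
  case (less k)
  have q1: "q > 1" using primepow_gt_Suc_0[OF q(1)] by simp
  show ?case
  proof (cases "k < d")
    case True
    then have "q ^ k \<le> q ^ (d - 1)" using q1 by (intro power_increasing) auto
    then have "Polynomial.degree (monom (1::'a) (q ^ k - 1)) \<le> q ^ (d - 1) - 1"
      by (simp add: degree_monom_eq)
    then show ?thesis by (metis cong_refl)
  next
    case False
    then obtain m where k: "k = d + m" using le_Suc_ex not_less by blast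
    \<comment> \<open>\<open>Q\<close> is the \<open>q ^ m\<close>-th power of
      \<open>f = z g\<close>, divided by \<open>z\<close>. Cancelling one \<open>z\<close> from
      \<open>f ^ (q ^ m) = z * g * f ^ (q ^ m - 1)\<close> shows that \<open>g\<close> divides it.
      Its top exponent is \<open>q ^ k - 1\<close>, and the others fall under the induction
      hypothesis since \<open>i + m < k\<close> for \<open>i < d\<close>.\<close>
    define Q where "Q = (\<Sum>i\<le>d. monom (c i ^ q ^ m) (q ^ (i + m) - 1))"
    have "monom 1 1 * Q = (\<Sum>i\<le>d. monom (c i) (q ^ i)) ^ (q ^ m)"
      unfolding linearized_power_eq[OF q] Q_def using q1 by (simp add: sum_distrib_left mult_monom)
    also have "\<dots> = monom 1 1 * (g * (\<Sum>i\<le>d. monom (c i) (q ^ i)) ^ (q ^ m - 1))"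
      using q1 power_minus_mult[of "q ^ m" "\<Sum>i\<le>d. monom (c i) (q ^ i)"]
        linearized_eq_X_times[of q c d] g by (simp add: mult_ac)
    finally have "g dvd Q" by (simp add: monom_eq_0_iff)
    then have Q0: "[Q = 0] (mod g)" by (simp add: cong_0_iff)
    have "\<exists>P. \<forall>i<d. [monom 1 (q ^ (i + m) - 1) = P i] (mod g)
        \<and> Polynomial.degree (P i) \<le> q ^ (d - 1) - 1"
      using less k by (intro choice_iff'[THEN iffD1]) auto
    then obtain P where P: "\<And>i. i < d \<Longrightarrow> [monom 1 (q ^ (i + m) - 1) = P i] (mod g)"
      "\<And>i. i < d \<Longrightarrow> Polynomial.degree (P i) \<le> q ^ (d - 1) - 1" by blast
    define a where "a = c d ^ q ^ m"
    have a: "a \<noteq> 0" using cd by (simp add: a_def)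
    have split: "Q = (\<Sum>i<d. Polynomial.smult (c i ^ q ^ m) (monom 1 (q ^ (i + m) - 1)))
        + Polynomial.smult a (monom 1 (q ^ k - 1))"
      by (simp add: Q_def k a_def smult_monom flip: lessThan_Suc_atMost)
    \<comment> \<open>Solve \<open>Q = 0\<close> modulo \<open>g\<close> for its top monomial, whose
      coefficient \<open>a\<close> is invertible, and replace each lower monomial by its low-degree
      representative.\<close>
    define S where "S = Polynomial.smult (- inverse a) (\<Sum>i<d. Polynomial.smult (c i ^ q ^ m) (P i))"
    \<comment> \<open>Scalars are written as constant polynomials so that \<open>cong_mult\<close>
      applies to them.\<close>
    have "monom 1 (q ^ k - 1) = [:inverse a:] * Q
        + [:- inverse a:] * (\<Sum>i<d. [:c i ^ q ^ m:] * monom 1 (q ^ (i + m) - 1))"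
      using a by (simp add: split smult_add_right)
    also have "[\<dots> = [:inverse a:] * 0 + [:- inverse a:] * (\<Sum>i<d. [:c i ^ q ^ m:] * P i)] (mod g)"
      by (intro cong_add cong_mult cong_sum cong_refl Q0 P) auto
    also have "[:inverse a:] * 0 + [:- inverse a:] * (\<Sum>i<d. [:c i ^ q ^ m:] * P i) = S"
      by (simp add: S_def)
    finally have "[monom 1 (q ^ k - 1) = S] (mod g)" .
    moreover have "Polynomial.degree S \<le> q ^ (d - 1) - 1"
      unfolding S_def
      by (intro order.trans[OF degree_smult_le] degree_sum_le)
        (use P(2) order.trans[OF degree_smult_le] in \<open>fastforce+\<close>)
    ultimately show ?thesis by blast
  qed
qed

theorem theorem3:
  fixes q d s :: nat
    and F\<^sub>q :: "'a::field set"
    and f :: "'a poly"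
    and c :: "nat \<Rightarrow> 'a"
    and H :: "'a fps"
    and k :: "nat \<Rightarrow> nat"
  assumes "primepow q"
    and "subfield F\<^sub>q (ring_of_type_algebra :: 'a ring)"
    and "card F\<^sub>q = q"
    and "f = (\<Sum>i\<le>d. monom (c i) (q ^ i))"
    and "c d \<noteq> 0"
    and "fps_to_fls H = neg_z_log_deriv f"
    and "1 \<le> s"
    and "s \<le> q"
    and "\<forall>i\<in>{1..s}. 1 \<le> k i"
  shows "(\<Prod>i=1..s. fps_nth H (q ^ k i - 1)) = fps_nth H ((\<Sum>i=1..s. q ^ k i) - s)"
proof -
  have q1: "q > 1" using primepow_gt_Suc_0[OF assms(1)] by simp
  have q0: "of_nat q = (0 :: 'a)"
    using of_nat_card_subfield_eq_0[OF assms(2)] assms(3) q1 card.infinite by fastforce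
  define g where "g = (\<Sum>i\<le>d. monom (c i) (q ^ i - 1))"
  have fg: "f = monom 1 1 * g"
    using linearized_eq_X_times[of q c d] q1 assms(4) g_def by simp
  have cg: "Polynomial.coeff g 0 = c 0"
  proof -
    have "Polynomial.coeff g 0 = (\<Sum>i\<le>d. if i = 0 then c i else 0)"
      unfolding g_def coeff_sum
      using q1 by (intro sum.cong) (auto dest: one_less_power[OF q1])
    then show ?thesis by simp
  qed
  have top: "Polynomial.coeff g (q ^ d - 1) = c d"
  proof -
    have "q ^ i - 1 = q ^ d - 1 \<longleftrightarrow> i = d" for i
    proof -
      have "q ^ i > 0" "q ^ d > 0" using q1 by auto
      then have "q ^ i - 1 = q ^ d - 1 \<longleftrightarrow> q ^ i = q ^ d" by linarith
      then show ?thesis using q1 by simp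
    qed
    then have "Polynomial.coeff g (q ^ d - 1) = (\<Sum>i\<le>d. if i = d then c i else 0)"
      unfolding g_def coeff_sum by (intro sum.cong) auto
    then show ?thesis by simp
  qed
  then have g0: "g \<noteq> 0" and degg: "Polynomial.degree g \<ge> q ^ d - 1"
    using assms(5) by (auto intro: le_degree)
  \<comment> \<open>For \<open>i > 0\<close> the factor \<open>q ^ i\<close> is zero in the field,
    so only the linear term of \<open>f\<close> survives.\<close>
  have "pderiv f = (\<Sum>i\<le>d. if i = 0 then [:c i:] else 0)"
    unfolding assms(4) higher_pderiv_sum[of 1, simplified] using q0
    by (intro sum.cong) (auto simp: pderiv_monom monom_0 power_0_left)
  then have "pderiv f = [:c 0:]" by simp
  then have pd: "poly_at_inf (pderiv f) = fls_const (c 0)" by (simp add: poly_at_inf_pCons)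
  have fX: "poly_at_inf f = fls_X_inv * poly_at_inf g"
    unfolding fg poly_at_inf_mult poly_at_inf_monom by simp
  have gH: "poly_at_inf g * fps_to_fls H = - fls_const (c 0)"
    unfolding assms(6) neg_z_log_deriv_def pd fX using g0 by (simp add: poly_at_inf_eq_0_iff)
  \<comment> \<open>The constant \<open>c 0\<close> has subdegree 0 and \<open>g\<close> has
    subdegree minus its degree, so the order of \<open>H\<close> must compensate.\<close>
  have subH: "int (Polynomial.degree g) \<le> fls_subdegree (fps_to_fls H)" if "H \<noteq> 0"
  proof -
    have "- int (Polynomial.degree g) + fls_subdegree (fps_to_fls H) = fls_subdegree (- fls_const (c 0))"
      unfolding gH[symmetric] using that g0
      by (simp add: poly_at_inf_eq_0_iff poly_at_inf_subdegree)
    then show ?thesis by simp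
  qed
  define M where "M p = fls_nth (poly_at_inf p * fps_to_fls H) 0 + Polynomial.coeff p 0" for p
  \<comment> \<open>The \<open>u ^ 0\<close> coefficient of \<open>g h H = - c 0 * h\<close> is
    \<open>- c 0 * h(0)\<close>, and the added term \<open>(g h)(0) = c 0 * h(0)\<close> cancels
    it.\<close>
  have M_mult: "M (g * h) = 0" for h
  proof -
    have "poly_at_inf (g * h) * fps_to_fls H = (poly_at_inf g * fps_to_fls H) * poly_at_inf h"
      by (simp add: poly_at_inf_mult mult_ac)
    also have "\<dots> = - (fls_const (c 0) * poly_at_inf h)" by (simp add: gH)
    finally have "poly_at_inf (g * h) * fps_to_fls H = - (fls_const (c 0) * poly_at_inf h)" .
    then show ?thesis by (simp add: M_def poly_at_inf_nth coeff_mult cg)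
  qed
  have M_cong: "M p = M r" if cong: "[p = r] (mod g)" for p r
  proof -
    obtain h where "p - r = g * h" using cong by (auto simp: cong_iff_dvd_diff)
    then have "M (p - r) = 0" using M_mult by simp
    then show ?thesis by (simp add: M_def poly_at_inf_diff algebra_simps)
  qed
  have M_low: "M p = Polynomial.coeff p 0" if "Polynomial.degree p < Polynomial.degree g" for p
  proof (cases "p = 0")
    case False
    then have "fls_nth (poly_at_inf p * fps_to_fls H) 0 = 0"
      using subH that by (intro fls_nth_mult_eq_0) (auto simp: poly_at_inf_subdegree)
    then show ?thesis by (simp add: M_def)
  qed (simp add: M_def)
  \<comment> \<open>At \<open>n = 0\<close> the added term of \<open>M\<close> would contribute an
    extra 1.\<close>
  have M_monom: "M (monom 1 n) = fps_nth H n" if "n > 0" for n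
    using that by (simp add: M_def poly_at_inf_monom fls_X_inv_power_times_conv_shift)
  have pos: "q ^ k i - 1 > 0" if "i \<in> {1..s}" for i
    using that assms(9) q1 one_less_power[of q "k i"] by force
  have sum_eq: "(\<Sum>i=1..s. q ^ k i) - s = (\<Sum>i=1..s. q ^ k i - 1)"
    using q1 by (subst sum_subtractf_nat) auto
  have total_pos: "(\<Sum>i=1..s. q ^ k i - 1) > 0"
    using assms(7) pos by (intro sum_pos) auto
  have monom_prod: "(\<Prod>i=1..s. monom (1::'a) (q ^ k i - 1)) = monom 1 (\<Sum>i=1..s. q ^ k i - 1)"
    by (rule prod_monom)
  show ?thesis
  \<comment> \<open>For \<open>d = 0\<close> the polynomial \<open>g\<close> is a nonzero constant,
    so no degree lies below that of \<open>g\<close>. The ideal is then the whole ring, hence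
    \<open>M\<close> is zero and both sides of the identity vanish.\<close>
  proof (cases "d = 0")
    case True
    then have "is_unit g" using assms(5) by (simp add: g_def is_unit_monom_0)
    then have "M p = 0" for p using M_cong[of p 0] M_mult[of 0] by (simp add: cong_0_iff unit_imp_dvd)
    then have "fps_nth H n = 0" if "n > 0" for n using M_monom[OF that] by simp
    then show ?thesis using total_pos pos assms(7) unfolding sum_eq
      by (subst prod_zero[where A = "{1..s}"]) auto
  next
    case False
    have "\<forall>i. \<exists>P. [monom 1 (q ^ k i - 1) = P] (mod g) \<and> Polynomial.degree P \<le> q ^ (d - 1) - 1"
      using monom_cong_low_degree[OF assms(1) q0 assms(5) g_def] by blast
    from choice[OF this] obtain P where P: "\<And>i. [monom 1 (q ^ k i - 1) = P i] (mod g)"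
      "\<And>i. Polynomial.degree (P i) \<le> q ^ (d - 1) - 1" by blast
    have qd: "q * q ^ (d - 1) = q ^ d" using False by (simp add: power_eq_if)
    have "q ^ d \<ge> q" using False q1 by (simp add: self_le_power)
    \<comment> \<open>The left side is \<open>q ^ d - q\<close>, and \<open>q > 1\<close>. This is
      the degree bound for \<open>q\<close> factors, which covers all \<open>s\<close> factors as
      \<open>s \<le> q\<close>.\<close>
    have "q * (q ^ (d - 1) - 1) < q ^ d - 1"
      unfolding diff_mult_distrib2 qd using \<open>q ^ d \<ge> q\<close> q1 by linarith
    then have low: "s * (q ^ (d - 1) - 1) < Polynomial.degree g"
      using degg assms(8) mult_le_mono1[of s q "q ^ (d - 1) - 1"] by linarith
    have "Polynomial.degree (\<Prod>i=1..s. P i) \<le> (\<Sum>i=1..s. Polynomial.degree (P i))"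
      using degree_prod_sum_le[of "{1..s}" P] by simp
    also have "\<dots> \<le> s * (q ^ (d - 1) - 1)"
      using sum_bounded_above[of "{1..s}" "\<lambda>i. Polynomial.degree (P i)"] P(2) by simp
    finally have deg: "Polynomial.degree (\<Prod>i=1..s. P i) < Polynomial.degree g" using low by linarith
    have H_single: "fps_nth H (q ^ k i - 1) = Polynomial.coeff (P i) 0" if i: "i \<in> {1..s}" for i
    proof -
      \<comment> \<open>Since \<open>s\<close> is at least 1, the degree bound for the product also
        covers a single factor.\<close>
      have "1 * (q ^ (d - 1) - 1) \<le> s * (q ^ (d - 1) - 1)"
        using assms(7) by (intro mult_le_mono1)
      then have "Polynomial.degree (P i) < Polynomial.degree g" using P(2)[of i] low by linarith
      then show ?thesis using M_monom[OF pos[OF i]] M_cong[OF P(1)] M_low by metis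
    qed
    have "(\<Prod>i=1..s. fps_nth H (q ^ k i - 1)) = (\<Prod>i=1..s. Polynomial.coeff (P i) 0)"
      using H_single by simp
    also have "\<dots> = Polynomial.coeff (\<Prod>i=1..s. P i) 0" by (simp add: poly_prod flip: poly_0_coeff_0)
    also have "\<dots> = M (\<Prod>i=1..s. P i)" using M_low[OF deg] by simp
    also have "\<dots> = M (monom 1 (\<Sum>i=1..s. q ^ k i - 1))"
      unfolding monom_prod[symmetric] by (intro M_cong cong_prod) (metis P(1) cong_sym)
    also have "\<dots> = fps_nth H ((\<Sum>i=1..s. q ^ k i) - s)"
      unfolding sum_eq by (rule M_monom[OF total_pos])
    finally show ?thesis .
  qed
qed

end
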